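(* Let $\Gamma$ be a countable group, let $A$ be a cancellative $\Gamma$-GCA in which every two elements have a meet (with respect to the canonical partial order $\le$), and let $\sim$ be an equivalence relation on $A$ such that the following hold: (1) If $a,b\in A$ are equidecomposable, then $a\sim b$. (2) For all $a,b,c,d\in A$ such that $a+c$ and $b+d$ are defined, if $a\sim b$ and $a+c\sim b+d$, then $c\sim d$. (3) For all $a,b\in A$, if $a\sim b$ and $a\perp\gamma b$ for every $\gamma\in\Gamma$, then $a=0$. Then for all $a,b\in A$, we have $a\sim b$ if and only if $a$ and $b$ are equidecomposable.
   Context: A generalized cardinal algebra (GCA) is a set $A$ with a partial binary operation $+$, a constant $0$, and a partial $\omega$-ary operation $\sum$ (written $\sum_n a_n=\sum(a_n)_{n\in\mathbb N}$) satisfying the following axioms, where asserting an equality in a conclusion includes asserting that the expressions in it are defined: (i) If $\sum_n a_n$ is defined, then $\sum_n a_n=a_0+\sum_{n\ge1}a_n$. (ii) If $\sum_n(a_n+b_n)$ is defined, then $\sum_n(a_n+b_n)=\sum_n a_n+\sum_n b_n$. (iii) For every $a\in A$, $a+0=0+a=a$. (iv) (Refinement) If $a+b=\sum_n c_n$, then there are $(a_n)_n$ and $(b_n)_n$ in $A$ with $a=\sum_n a_n$, $b=\sum_n b_n$ and $c_n=a_n+b_n$ for all $n$. (v) (Remainder) If $(a_n)_n$ and $(b_n)_n$ satisfy $a_n=b_n+a_{n+1}$ for all $n$, then there is $c\in A$ such that $a_n=c+\sum_{i\ge n}b_i$ for each $n$. These axioms imply that $\sum$ is invariant under permutations of the index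 set, so sums over countable index sets make sense (finite families are padded with zeros). The relation $a\le b\iff\exists c\,[a+c=b]$ is a partial order on $A$ with least element $0$; meets $\wedge$ are taken with respect to $\le$, and $a\perp b$ means $a\wedge b=0$. A GCA $A$ is cancellative if for all $a,b\in A$, $a+b=a$ implies $b=0$. A homomorphism of GCAs is a map $\phi$ such that $a=b+c$ implies $\phi(a)=\phi(b)+\phi(c)$, $\phi(0)=0$, and $a=\sum_n a_n$ implies $\phi(a)=\sum_n\phi(a_n)$. A $\Gamma$-GCA is a GCA $A$ with a group action of the countable group $\Gamma$ on the set $A$ such that each map $a\mapsto\gamma a$ is a homomorphism. Elements $a,b$ of a $\Gamma$-GCA $A$ are equidecomposable if there are $(a_\gamma)_{\gamma\in\Gamma}$ in $A$ with $a=\sum_\gamma a_\gamma$ and $b=\sum_\gamma\gamma a_\gamma$. *)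

theory Defs
  imports "HOL-Algebra.Group_Action" "HOL-Library.Countable_Set"
begin

text \<open>
  The underlying set of a structure is the type \<open>'a\<close>; as a GCA contains 0, this excludes nothing.
  Partial operations take values in an option type, and \<open>None\<close> means undefined.
\<close>

record 'a gca_struct =
  gadd :: "'a \<Rightarrow> 'a \<Rightarrow> 'a option"
  gzero :: "'a"
  gsum :: "(nat \<Rightarrow> 'a) \<Rightarrow> 'a option"

locale gca =
  fixes A :: "'a gca_struct"
  assumes sum_split:
      "gsum A a = Some s \<Longrightarrow>
        \<exists>t. gsum A (\<lambda>n. a (Suc n)) = Some t \<and> gadd A (a 0) t = Some s"
    and sum_add:
      "\<lbrakk>\<And>n. gadd A (a n) (b n) = Some (c n); gsum A c = Some s\<rbrakk> \<Longrightarrow>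
        \<exists>u v. gsum A a = Some u \<and> gsum A b = Some v \<and> gadd A u v = Some s"
    and add_zero: "gadd A x (gzero A) = Some x"
    and zero_add: "gadd A (gzero A) x = Some x"
    and refinement:
      "\<lbrakk>gadd A x y = Some s; gsum A c = Some s\<rbrakk> \<Longrightarrow>
        \<exists>a b. gsum A a = Some x \<and> gsum A b = Some y \<and> (\<forall>n. gadd A (a n) (b n) = Some (c n))"
    and remainder:
      "(\<And>n. gadd A (b n) (a (Suc n)) = Some (a n)) \<Longrightarrow>
        \<exists>c. \<forall>n. \<exists>t. gsum A (\<lambda>i. b (n + i)) = Some t \<and> gadd A c t = Some (a n)"

definition gca_le :: "'a gca_struct \<Rightarrow> 'a \<Rightarrow> 'a \<Rightarrow> bool" where
  "gca_le A a b \<longleftrightarrow> (\<exists>c. gadd A a c = Some b)"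

definition is_meet :: "'a gca_struct \<Rightarrow> 'a \<Rightarrow> 'a \<Rightarrow> 'a \<Rightarrow> bool" where
  "is_meet A a b m \<longleftrightarrow>
    gca_le A m a \<and> gca_le A m b \<and> (\<forall>x. gca_le A x a \<longrightarrow> gca_le A x b \<longrightarrow> gca_le A x m)"

definition gca_perp :: "'a gca_struct \<Rightarrow> 'a \<Rightarrow> 'a \<Rightarrow> bool" where
  "gca_perp A a b \<longleftrightarrow> is_meet A a b (gzero A)"

definition cancellative :: "'a gca_struct \<Rightarrow> bool" where
  "cancellative A \<longleftrightarrow> (\<forall>a b. gadd A a b = Some a \<longrightarrow> b = gzero A)"

text \<open>
  Sum over a countable index set, along the enumeration \<^const>\<open>to_nat_on\<close>: a bijection onto
  the naturals if \<open>I\<close> is infinite, onto \<open>{..<card I}\<close> if \<open>I\<close> is finite, in which case the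
  family is padded with zeros. The choice of enumeration is immaterial in a GCA, since the
  axioms make \<^const>\<open>gsum\<close> invariant under permutations.
\<close>

definition gsum_on :: "'a gca_struct \<Rightarrow> 'i set \<Rightarrow> ('i \<Rightarrow> 'a) \<Rightarrow> 'a option" where
  "gsum_on A I f =
    gsum A (\<lambda>n. if n \<in> to_nat_on I ` I then f (from_nat_into I n) else gzero A)"

locale gca_hom = dom: gca A + cod: gca B
  for A :: "'a gca_struct" and B :: "'b gca_struct" +
  fixes f :: "'a \<Rightarrow> 'b"
  assumes hom_add: "gadd A b c = Some a \<Longrightarrow> gadd B (f b) (f c) = Some (f a)"
    and hom_zero: "f (gzero A) = gzero B"
    and hom_sum: "gsum A x = Some a \<Longrightarrow> gsum B (\<lambda>n. f (x n)) = Some (f a)"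

locale group_gca = gca A + group_action \<Gamma> UNIV act
  for A :: "'a gca_struct" and \<Gamma> :: "('g, 'm) monoid_scheme" and act :: "'g \<Rightarrow> 'a \<Rightarrow> 'a" +
  assumes countable_group: "countable (carrier \<Gamma>)"
    and act_hom: "\<gamma> \<in> carrier \<Gamma> \<Longrightarrow> gca_hom A A (act \<gamma>)"

definition equidecomposable ::
    "'a gca_struct \<Rightarrow> ('g, 'm) monoid_scheme \<Rightarrow> ('g \<Rightarrow> 'a \<Rightarrow> 'a) \<Rightarrow> 'a \<Rightarrow> 'a \<Rightarrow> bool" where
  "equidecomposable A \<Gamma> act a b \<longleftrightarrow>
    (\<exists>x. gsum_on A (carrier \<Gamma>) x = Some a \<and>
         gsum_on A (carrier \<Gamma>) (\<lambda>\<gamma>. act \<gamma> (x \<gamma>)) = Some b)"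

end

(* Exhaust a and b greedily along an enumeration of the group: at stage n, split off from the
   current remainders the largest piece of a that the n-th group element carries into b. By the
   remainder axiom what is never used up are elements c of a and d of b, and the part removed from
   a is equidecomposable with the part removed from b, so c ~ d by (2). By maximality
   and cancellativity c is disjoint from all translates of d, so c = 0 by (3), and then d = 0. *)
theory Submission imports Defs begin

context gca
begin

lemma gsum_zero: "gsum A (\<lambda>n. gzero A) = Some (gzero A)"
proof -
  \<comment> \<open>\<open>remainder\<close> for the constant zero sequences yields only that the
    sum is defined; its value \<open>t\<close> still has to be identified.\<close>
  obtain t where t: "gsum A (\<lambda>n. gzero A) = Some t"
    using remainder[of "\<lambda>n. gzero A" "\<lambda>n. gzero A"] add_zero by auto
  (* refining t + 0 = t exhibits 0 as the value of some sum, to which zeros can be added *)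
  obtain a b where "gsum A a = Some t" and b: "gsum A b = Some (gzero A)"
    using refinement[OF add_zero t] by blast
  obtain u v where "gsum A (\<lambda>n. gzero A) = Some u" "gsum A b = Some v"
      "gadd A u v = Some (gzero A)"
    using sum_add[of "\<lambda>n. gzero A" b b, OF zero_add b] by blast
  then show ?thesis using t b add_zero by auto
qed

text \<open>Ties binary addition to infinite sums, so that \<open>sum_add\<close> can prove laws of
  \<open>gadd\<close>. The sequence \<open>s, b, 0, 0, ...\<close> lists the tail sums, and
  \<open>remainder\<close> applies to it.\<close>

lemma gsum_pair:
  assumes "gadd A a b = Some s"
  shows "gsum A (\<lambda>n. if n = 0 then a else if n = 1 then b else gzero A) = Some s"
proof -
  let ?a = "\<lambda>n::nat. if n = 0 then s else if n = 1 then b else gzero A"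
  let ?b = "\<lambda>n::nat. if n = 0 then a else if n = 1 then b else gzero A"
  have "gadd A (?b n) (?a (Suc n)) = Some (?a n)" for n
    using assms by (auto simp: add_zero)
  then obtain c where c: "\<And>n. \<exists>t. gsum A (\<lambda>i. ?b (n + i)) = Some t \<and> gadd A c t = Some (?a n)"
    using remainder[of ?b ?a] by blast
  \<comment> \<open>From index 2 on both sequences vanish, which reads
    \<open>c + 0 = 0\<close>.\<close>
  have "c = gzero A" using c[of 2] gsum_zero add_zero by auto
  moreover have "\<exists>t. gsum A ?b = Some t \<and> gadd A c t = Some s"
    using c[of 0] by (simp only: add_0 if_True simp_thms)
  ultimately show ?thesis using zero_add by auto
qed

lemma gsum_single: "gsum A (\<lambda>n. if n = 0 then a else gzero A) = Some a"
proof -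
  have "(\<lambda>n::nat. if n = 0 then a else if n = 1 then gzero A else gzero A)
      = (\<lambda>n. if n = 0 then a else gzero A)" by auto
  then show ?thesis using gsum_pair[OF add_zero] by metis
qed

text \<open>Write \<open>(a, b, 0, ...)\<close> as \<open>(0, b, 0, ...) + (a, 0, 0, ...)\<close>
  and sum both sides with \<open>sum_add\<close>.\<close>

lemma gadd_commute:
  assumes "gadd A a b = Some s"
  shows "gadd A b a = Some s"
proof -
  let ?b = "\<lambda>n::nat. if n = 1 then b else gzero A"
  let ?a = "\<lambda>n::nat. if n = 0 then a else gzero A"
  let ?c = "\<lambda>n::nat. if n = 0 then a else if n = 1 then b else gzero A"
  have "gadd A (?b n) (?a n) = Some (?c n)" for n by (auto simp: add_zero zero_add)
  then obtain u v where u: "gsum A ?b = Some u" and v: "gsum A ?a = Some v"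
      and uv: "gadd A u v = Some s"
    using sum_add[of ?b ?a ?c s] gsum_pair[OF assms] by blast
  have "u = b" using sum_split[OF u] gsum_single[of b] zero_add by auto
  moreover have "v = a" using v gsum_single[of a] by simp
  ultimately show ?thesis using uv by simp
qed

text \<open>Write \<open>(p, c, 0, ...)\<close> as \<open>(a, 0, 0, ...) + (b, c, 0, ...)\<close>;
  summing the second sequence also shows that \<open>b + c\<close> is defined.\<close>

lemma gadd_assoc:
  assumes ab: "gadd A a b = Some p" and pc: "gadd A p c = Some s"
  obtains q where "gadd A b c = Some q" "gadd A a q = Some s"
proof -
  let ?a = "\<lambda>n::nat. if n = 0 then a else gzero A"
  let ?b = "\<lambda>n::nat. if n = 0 then b else if n = 1 then c else gzero A"
  let ?c = "\<lambda>n::nat. if n = 0 then p else if n = 1 then c else gzero A"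
  have "gadd A (?a n) (?b n) = Some (?c n)" for n using ab by (auto simp: zero_add)
  then obtain u v where u: "gsum A ?a = Some u" and v: "gsum A ?b = Some v"
      and uv: "gadd A u v = Some s"
    using sum_add[of ?a ?b ?c s] gsum_pair[OF pc] by blast
  have "u = a" using u gsum_single[of a] by simp
  moreover have "gadd A b c = Some v" using sum_split[OF v] gsum_single[of c] by auto
  ultimately show thesis using uv that by blast
qed

lemma gadd_assoc':
  assumes "gadd A b c = Some q" and "gadd A a q = Some s"
  obtains p where "gadd A a b = Some p" "gadd A p c = Some s"
  using assms by (meson gadd_assoc gadd_commute)

lemma gca_le_trans: "gca_le A a b \<Longrightarrow> gca_le A b c \<Longrightarrow> gca_le A a c"
  unfolding gca_le_def by (meson gadd_assoc)

lemma gca_le_add_mono: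
  assumes "gca_le A x a'" and "gadd A m a' = Some a"
  obtains p where "gadd A m x = Some p" "gca_le A p a"
  using assms unfolding gca_le_def by (meson gadd_assoc')

text \<open>If \<open>m + x + y = m\<close>, cancellativity gives \<open>x + y = 0\<close>. This
  bounds \<open>x\<close> by zero, which is the form that \<open>gca_perp_iff\<close> asks
  for.\<close>

lemma gca_le_zero_of_add_le:
  assumes "cancellative A" and "gadd A m x = Some p" and "gca_le A p m"
  shows "gca_le A x (gzero A)"
proof -
  obtain y where "gadd A p y = Some m" using assms(3) unfolding gca_le_def by blast
  then obtain q where "gadd A x y = Some q" "gadd A m q = Some m"
    using gadd_assoc assms(2) by blast
  then show ?thesis using assms(1) unfolding cancellative_def gca_le_def by blast
qed

lemma gca_perp_iff: "gca_perp A a b \<longleftrightarrow> (\<forall>x. gca_le A x a \<longrightarrow> gca_le A x b \<longrightarrow> gca_le A x (gzero A))"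
  using zero_add unfolding gca_perp_def is_meet_def gca_le_def by blast

lemma gsum_on_to_nat_on:
  assumes "countable I" and "\<And>n. n \<notin> to_nat_on I ` I \<Longrightarrow> f n = gzero A"
    and "\<And>i. i \<in> I \<Longrightarrow> x i = f (to_nat_on I i)"
  shows "gsum_on A I x = gsum A f"
proof -
  have "(if n \<in> to_nat_on I ` I then x (from_nat_into I n) else gzero A) = f n" for n
    using assms by auto
  then show ?thesis unfolding gsum_on_def by presburger
qed

end

context group_gca
begin

lemma act_add:
  "\<gamma> \<in> carrier \<Gamma> \<Longrightarrow> gadd A b c = Some a \<Longrightarrow> gadd A (act \<gamma> b) (act \<gamma> c) = Some (act \<gamma> a)"
  using gca_hom.hom_add[OF act_hom] by blast

lemma act_zero: "\<gamma> \<in> carrier \<Gamma> \<Longrightarrow> act \<gamma> (gzero A) = gzero A"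
  using gca_hom.hom_zero[OF act_hom] by blast

lemma act_le: "\<gamma> \<in> carrier \<Gamma> \<Longrightarrow> gca_le A a b \<Longrightarrow> gca_le A (act \<gamma> a) (act \<gamma> b)"
  unfolding gca_le_def using act_add by blast

lemma group_\<Gamma>: "group \<Gamma>"
  by (rule group_hom.axioms(1)[OF group_hom])

lemma inv_carrier: "\<gamma> \<in> carrier \<Gamma> \<Longrightarrow> inv\<^bsub>\<Gamma>\<^esub> \<gamma> \<in> carrier \<Gamma>"
  by (rule group.inv_closed[OF group_\<Gamma>])

lemma act_inv_act: "\<gamma> \<in> carrier \<Gamma> \<Longrightarrow> act (inv\<^bsub>\<Gamma>\<^esub> \<gamma>) (act \<gamma> a) = a"
  by (rule orbit_sym_aux[OF _ UNIV_I refl])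

lemma act_act_inv: "\<gamma> \<in> carrier \<Gamma> \<Longrightarrow> act \<gamma> (act (inv\<^bsub>\<Gamma>\<^esub> \<gamma>) a) = a"
  using act_inv_act[OF inv_carrier] group.inv_inv[OF group_\<Gamma>] by simp

text \<open>Take \<open>m\<close> to be the meet of \<open>a\<close> and the translate of
  \<open>b\<close> by the inverse of \<gamma>. A further piece \<open>x\<close> would make
  \<open>m + x\<close> another common lower bound, so \<open>m + x\<close> lies below
  \<open>m\<close>.\<close>

lemma split_off_maximal_piece:
  assumes "cancellative A" and "\<And>a b. \<exists>m. is_meet A a b m" and \<gamma>: "\<gamma> \<in> carrier \<Gamma>"
  obtains m a' b' where "gadd A m a' = Some a" "gadd A (act \<gamma> m) b' = Some b"
    "\<And>x. gca_le A x a' \<Longrightarrow> gca_le A (act \<gamma> x) b' \<Longrightarrow> gca_le A x (gzero A)"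
proof -
  obtain m where m: "is_meet A a (act (inv\<^bsub>\<Gamma>\<^esub> \<gamma>) b) m" using assms(2) by blast
  obtain a' where a': "gadd A m a' = Some a" using m unfolding is_meet_def gca_le_def by blast
  have "gca_le A (act \<gamma> m) b"
    using m act_le[OF \<gamma>, of m "act (inv\<^bsub>\<Gamma>\<^esub> \<gamma>) b"] act_act_inv[OF \<gamma>]
    unfolding is_meet_def by simp
  then obtain b' where b': "gadd A (act \<gamma> m) b' = Some b" unfolding gca_le_def by blast
  have "gca_le A x (gzero A)" if x: "gca_le A x a'" and \<gamma>x: "gca_le A (act \<gamma> x) b'" for x
  proof -
    obtain p where p: "gadd A m x = Some p" "gca_le A p a" using gca_le_add_mono[OF x a'] .
    obtain q where "gadd A (act \<gamma> m) (act \<gamma> x) = Some q" "gca_le A q b"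
      using gca_le_add_mono[OF \<gamma>x b'] .
    then have "gca_le A (act \<gamma> p) b" using act_add[OF \<gamma> p(1)] by simp
    then have "gca_le A p (act (inv\<^bsub>\<Gamma>\<^esub> \<gamma>) b)"
      using act_le[OF inv_carrier[OF \<gamma>], of "act \<gamma> p" b] act_inv_act[OF \<gamma>] by simp
    then have "gca_le A p m" using m p(2) unfolding is_meet_def by blast
    then show ?thesis using gca_le_zero_of_add_le[OF assms(1) p(1)] by blast
  qed
  then show thesis using that a' b' by blast
qed

text \<open>The greedy exhaustion itself, free of the equivalence relation.\<close>

lemma equidecomposable_up_to_disjoint:
  assumes "cancellative A" and "\<And>a b. \<exists>m. is_meet A a b m"
  obtains c s d t where "gadd A c s = Some a" "gadd A d t = Some b"
    "equidecomposable A \<Gamma> act s t" "\<forall>\<gamma>\<in>carrier \<Gamma>. gca_perp A c (act \<gamma> d)"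
proof -
  let ?G = "carrier \<Gamma>"
  let ?I = "to_nat_on ?G ` ?G"
  let ?g = "from_nat_into ?G"
  \<comment> \<open>Holds for every \<open>n\<close>, even past the order of a finite group, because
    the group is nonempty.\<close>
  have g: "?g n \<in> ?G" for n
    using monoid.one_closed[OF group.is_monoid[OF group_\<Gamma>]] by (intro from_nat_into) blast
  (* Outside ?I, which happens only for finite groups, nothing is removed, as gsum_on pads with zeros. *)
  define Q where "Q n p q m \<longleftrightarrow>
      gadd A m (fst q) = Some (fst p) \<and> gadd A (act (?g n) m) (snd q) = Some (snd p) \<and>
      (n \<notin> ?I \<longrightarrow> m = gzero A) \<and>
      (n \<in> ?I \<longrightarrow> (\<forall>x. gca_le A x (fst q) \<longrightarrow> gca_le A (act (?g n) x) (snd q)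
        \<longrightarrow> gca_le A x (gzero A)))" for n p q m
  have "\<exists>q m. Q n p q m" for n p
  proof (cases "n \<in> ?I")
    case True
    obtain m a' b' where "gadd A m a' = Some (fst p)" "gadd A (act (?g n) m) b' = Some (snd p)"
      "\<And>x. gca_le A x a' \<Longrightarrow> gca_le A (act (?g n) x) b' \<Longrightarrow> gca_le A x (gzero A)"
      using split_off_maximal_piece[OF assms g[of n]] by blast
    then have "Q n p (a', b') m" using True unfolding Q_def by simp
    then show ?thesis by blast
  next
    case False
    have "Q n p p (gzero A)" using False zero_add act_zero[OF g] unfolding Q_def by simp
    then show ?thesis by blast
  qed
  \<comment> \<open>The invariant passed to the choice principle only fixes the starting
    pair.\<close>
  then obtain p where p0: "p 0 = (a, b)" and "\<And>n. \<exists>m. Q n (p n) (p (Suc n)) m"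
    using dependent_nat_choice[of "\<lambda>n p. n = 0 \<longrightarrow> p = (a, b)" "\<lambda>n p q. \<exists>m. Q n p q m"]
    by blast
  then obtain m where Q: "\<And>n. Q n (p n) (p (Suc n)) (m n)" by metis
  \<comment> \<open>A single \<open>c\<close> serves all stages: stage 0 gives
    \<open>a = c + s\<close>, and later stages put \<open>c\<close> below every remainder of
    \<open>a\<close>. The same holds for \<open>d\<close> and \<open>b\<close>.\<close>
  obtain c where c: "\<And>n. \<exists>t. gsum A (\<lambda>i. m (n + i)) = Some t \<and> gadd A c t = Some (fst (p n))"
    using remainder[of m "\<lambda>n. fst (p n)"] Q unfolding Q_def by blast
  obtain d where d: "\<And>n. \<exists>t. gsum A (\<lambda>i. act (?g (n + i)) (m (n + i))) = Some t
      \<and> gadd A d t = Some (snd (p n))"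
    using remainder[of "\<lambda>n. act (?g n) (m n)" "\<lambda>n. snd (p n)"] Q unfolding Q_def by blast
  obtain s where s: "gsum A m = Some s" "gadd A c s = Some a" using c[of 0] p0 by auto
  obtain t where t: "gsum A (\<lambda>n. act (?g n) (m n)) = Some t" "gadd A d t = Some b"
    using d[of 0] p0 by auto
  have m0: "m n = gzero A" if "n \<notin> ?I" for n using Q[of n] that unfolding Q_def by blast
  \<comment> \<open>Each group element receives the piece removed at its own stage.\<close>
  let ?x = "\<lambda>\<gamma>. m (to_nat_on ?G \<gamma>)"
  have "gsum_on A ?G ?x = Some s"
    using gsum_on_to_nat_on[of ?G m ?x, OF countable_group m0] s by simp
  moreover have "gsum_on A ?G (\<lambda>\<gamma>. act \<gamma> (?x \<gamma>)) = Some t"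
    using gsum_on_to_nat_on[of ?G "\<lambda>n. act (?g n) (m n)" "\<lambda>\<gamma>. act \<gamma> (?x \<gamma>)", OF countable_group]
      m0 act_zero[OF g] countable_group t by simp
  ultimately have "equidecomposable A \<Gamma> act s t" unfolding equidecomposable_def by blast
  moreover have "gca_perp A c (act \<gamma> d)" if \<gamma>: "\<gamma> \<in> ?G" for \<gamma>
    unfolding gca_perp_iff
  proof (intro allI impI)
    fix x assume xc: "gca_le A x c" and xd: "gca_le A x (act \<gamma> d)"
    \<comment> \<open>Since \<open>x\<close> lies below \<gamma>\<open>d\<close>, its translate by
      the inverse of \<gamma> lies below \<open>d\<close>, so the maximality to use is that of the
      stage treating this inverse.\<close>
    define n where "n = to_nat_on ?G (inv\<^bsub>\<Gamma>\<^esub> \<gamma>)"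
    have n: "n \<in> ?I" "?g n = inv\<^bsub>\<Gamma>\<^esub> \<gamma>"
      using inv_carrier[OF \<gamma>] countable_group unfolding n_def by auto
    have "gca_le A c (fst (p (Suc n)))" "gca_le A d (snd (p (Suc n)))"
      using c[of "Suc n"] d[of "Suc n"] unfolding gca_le_def by blast+
    moreover have "gca_le A (act (?g n) x) d"
      using act_le[OF inv_carrier[OF \<gamma>] xd] act_inv_act[OF \<gamma>] n by simp
    ultimately show "gca_le A x (gzero A)"
      using Q[of n] n(1) xc gca_le_trans unfolding Q_def by blast
  qed
  ultimately show thesis using that s t by blast
qed

end

theorem theorem1p1:
  fixes A :: "'a gca_struct"
    and \<Gamma> :: "('g, 'm) monoid_scheme"
    and act :: "'g \<Rightarrow> 'a \<Rightarrow> 'a"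
    and R :: "'a \<Rightarrow> 'a \<Rightarrow> bool"
  assumes "group_gca A \<Gamma> act"
    and "cancellative A"
    and "\<And>a b. \<exists>m. is_meet A a b m"
    and "equivp R"
    and "\<And>a b. equidecomposable A \<Gamma> act a b \<Longrightarrow> R a b"
    and "\<And>a b c d s t. \<lbrakk>gadd A a c = Some s; gadd A b d = Some t; R a b; R s t\<rbrakk> \<Longrightarrow> R c d"
    and "\<And>a b. \<lbrakk>R a b; \<And>\<gamma>. \<gamma> \<in> carrier \<Gamma> \<Longrightarrow> gca_perp A a (act \<gamma> b)\<rbrakk> \<Longrightarrow> a = gzero A"
  shows "\<forall>a b. R a b \<longleftrightarrow> equidecomposable A \<Gamma> act a b"
proof -
  interpret group_gca A \<Gamma> act by (rule assms(1))
  have "equidecomposable A \<Gamma> act a b" if R: "R a b" for a b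
  proof -
    obtain c s d t where cs: "gadd A c s = Some a" and dt: "gadd A d t = Some b"
      and st: "equidecomposable A \<Gamma> act s t"
      and perp: "\<forall>\<gamma>\<in>carrier \<Gamma>. gca_perp A c (act \<gamma> d)"
      using equidecomposable_up_to_disjoint[OF assms(2,3)] .
    \<comment> \<open>Hypothesis (2) cancels first summands, so \<open>s\<close> and
      \<open>t\<close> are moved to the front.\<close>
    have cd: "R c d"
      using assms(6)[OF gadd_commute[OF cs] gadd_commute[OF dt] assms(5)[OF st] R] .
    have c: "c = gzero A" using assms(7)[OF cd] perp by blast
    \<comment> \<open>Hypothesis (3) only kills its first argument; it is applied again with the
      roles exchanged, now trivially since translates of \<open>c = 0\<close> are zero.\<close>
    have "gca_perp A d (act \<gamma> c)" if "\<gamma> \<in> carrier \<Gamma>" for \<gamma>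
      using act_zero[OF that] c unfolding gca_perp_iff by simp
    then have "d = gzero A" by (rule assms(7)[OF equivp_symp[OF assms(4) cd]])
    then show ?thesis using c cs dt st zero_add by simp
  qed
  then show ?thesis using assms(5) by blast
qed

end
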